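(* As $n\to+\infty$ ($n$ a positive integer), $$\left(1+\frac{z}{n}\right)^n\to e^z$$ uniformly on compact subsets of $\mathbb C$. *)

theory Defs
  imports "HOL-Analysis.Analysis"
begin

end

theory Submission
  imports Defs
begin

text \<open>
  Both $(1+z/n)^n$ and $e^z = (e^{z/n})^n$ are $n$-th powers, and their bases $1 + w$ and $e^w$,
  where $w = z/n$, differ only by the Taylor remainder, of norm at most $e^{|w|} |w|^2$.
  Both bases have norm at most $e^{|w|}$, so passing to the $n$-th power enlarges the
  difference by a factor of at most $n e^{(n-1)|w|}$ (\<open>norm_power_diff_le_scaled\<close>).
  As $n|w| = |z|$, the error is at most $e^{|z|} |z|^2 / n$
  (\<open>norm_compound_power_minus_exp_le\<close>). The convergence is thus
  uniform wherever $|z|$ is bounded, in particular on compact sets.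
\<close>

text \<open>
  Dividing by $M^n$ reduces this to the case of norms at most $1$, where telescoping
  $a^n - b^n$ gives $n$ terms, each of norm at most that of $a - b$.
\<close>

lemma norm_power_diff_le_scaled:
  fixes a b :: "'a::real_normed_field"
  assumes "norm a \<le> M" "norm b \<le> M" "0 < M"
  shows "norm (a ^ n - b ^ n) \<le> M ^ n * (of_nat n * (norm (a - b) / M))"
proof -
  define c :: 'a where "c = of_real M"
  have c: "c \<noteq> 0" "norm c = M"
    using \<open>0 < M\<close> by (auto simp: c_def)
  have "norm (a ^ n - b ^ n) = M ^ n * norm ((a / c) ^ n - (b / c) ^ n)"
    using c \<open>0 < M\<close>
    by (simp add: power_divide norm_divide norm_power flip: diff_divide_distrib)
  also have "\<dots> \<le> M ^ n * (of_nat n * norm (a / c - b / c))"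
    using assms c by (intro mult_left_mono norm_power_diff) (auto simp: norm_divide)
  also have "norm (a / c - b / c) = norm (a - b) / M"
    using c by (simp add: norm_divide flip: diff_divide_distrib)
  finally show ?thesis .
qed

lemma norm_compound_power_minus_exp_le:
  fixes z :: "'a::{banach,real_normed_field}"
  assumes "0 < n"
  shows "norm ((1 + z / of_nat n) ^ n - exp z) \<le> exp (norm z) * (norm z)\<^sup>2 / of_nat n"
proof -
  define w where "w = z / of_nat n"
  define M where "M = exp (norm w)"
  have norm_w: "norm w = norm z / of_nat n"
    by (simp add: w_def norm_divide)
  have "norm (1 + w) \<le> 1 + norm w"
    using norm_triangle_ineq [of 1 w] by simp
  then have base: "norm (1 + w) \<le> M"
    unfolding M_def by (rule order_trans) (rule exp_ge_add_one_self)
  have remainder: "norm ((1 + w) - exp w) \<le> M * (norm w)\<^sup>2"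
    using Taylor_exp_field [of w 1]
    by (simp add: M_def norm_minus_commute power2_eq_square)
  have exp_w: "exp w ^ n = exp z"
    using assms by (simp add: w_def flip: exp_of_nat_mult)
  have M_power: "M ^ n = exp (norm z)"
    using assms by (simp add: M_def norm_w flip: exp_of_nat_mult)
  have "norm ((1 + w) ^ n - exp w ^ n) \<le> M ^ n * (of_nat n * (norm ((1 + w) - exp w) / M))"
    by (rule norm_power_diff_le_scaled [OF base]) (auto simp: M_def norm_exp)
  also have "\<dots> \<le> M ^ n * (of_nat n * (norm w)\<^sup>2)"
    using remainder by (intro mult_left_mono) (auto simp: M_def field_simps)
  also have "\<dots> = exp (norm z) * (norm z)\<^sup>2 / of_nat n"
    using assms by (simp add: M_power norm_w power2_eq_square)
  finally show ?thesis
    by (simp add: exp_w flip: w_def)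
qed

theorem corollary1p3:
  fixes K :: "complex set"
  assumes "compact K"
  shows "uniform_limit K (\<lambda>n z. (1 + z / of_nat n) ^ n) exp sequentially"
proof -
  obtain R where R: "\<And>z. z \<in> K \<Longrightarrow> norm z \<le> R"
    using compact_imp_bounded [OF assms] by (auto simp: bounded_iff)
  have "uniform_limit K (\<lambda>n z. (1 + z / of_nat n) ^ n - exp z) (\<lambda>_. 0) sequentially"
  proof (rule uniform_limit_null_comparison)
    show "\<forall>\<^sub>F n in sequentially. \<forall>z\<in>K.
        norm ((1 + z / of_nat n) ^ n - exp z) \<le> exp R * R\<^sup>2 / of_nat n"
    proof (intro eventually_mono [OF eventually_gt_at_top [of 0]] ballI)
      fix n :: nat and z assume n: "0 < n" and "z \<in> K"
      have "norm ((1 + z / of_nat n) ^ n - exp z) \<le> exp (norm z) * (norm z)\<^sup>2 / of_nat n"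
        by (rule norm_compound_power_minus_exp_le [OF n])
      also have "\<dots> \<le> exp R * R\<^sup>2 / of_nat n"
        using R [OF \<open>z \<in> K\<close>] by (intro divide_right_mono mult_mono power_mono) auto
      finally show "norm ((1 + z / of_nat n) ^ n - exp z) \<le> exp R * R\<^sup>2 / of_nat n" .
    qed
    show "uniform_limit K (\<lambda>n z. exp R * R\<^sup>2 / of_nat n) (\<lambda>_. 0) sequentially"
      using lim_const_over_n [of "exp R * R\<^sup>2"]
      by (auto simp: uniform_limit_iff tendsto_iff elim: eventually_mono)
  qed
  then show ?thesis
    by (simp add: uniform_limit_iff dist_norm)
qed

end
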